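(* Let $T$ be a tree of diameter $d\ge 2$ with $n$ vertices. If $d=2\ell$ for an integer $\ell$, then $W(T)\le (n-1)\,g_\ell(n)$. If $d=2\ell+1$ for an integer $\ell$, then $W(T)\le (n-2)\,g_\ell(n)+\frac{n^2}{4}$.
   Context: The Wiener index $W(T)$ is the sum of distances over all unordered pairs of distinct vertices. The functions $g_k$ ($k\ge1$) are defined by $g_1(n)=n-1$ and $g_k(n)=n+g_{k-1}(n)-2\sqrt{g_{k-1}(n)}$ for $k>1$. *)

theory Defs
  imports Complex_Main "Graph_Theory.Graph_Theory"
begin

text \<open>
  Finite simple graphs are the symmetric digraphs of locale \<open>graph\<close>: every edge is a pair of
  opposite arcs. In such a digraph the closed walk along an edge and back counts as a \<open>cycle\<close>, so
  the library's \<open>forest\<close> and \<open>tree\<close> would only admit edgeless graphs. The cycles of the underlying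
  undirected graph are exactly those of length at least 3.
\<close>

definition undirected_tree :: "('a, 'b) pre_digraph \<Rightarrow> bool" where
  "undirected_tree G \<longleftrightarrow>
     graph G \<and> Digraph_Component.connected G \<and>
     \<not> (\<exists>p. pre_digraph.cycle G p \<and> length p \<ge> 3)"

text \<open>
  All arcs have weight 1, so the cost of a walk is its length. The extended-real distance is
  infinite between different components, and is then sent to 0; this does not occur in a tree.
\<close>

definition graph_dist :: "('a, 'b) pre_digraph \<Rightarrow> 'a \<Rightarrow> 'a \<Rightarrow> real" where
  "graph_dist G u v = real_of_ereal (wf_digraph.\<mu> G (\<lambda>_. 1) u v)"

definition graph_diameter :: "('a, 'b) pre_digraph \<Rightarrow> real" where
  "graph_diameter G = Max {graph_dist G u v | u v. u \<in> verts G \<and> v \<in> verts G}"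

text \<open>
  The sum ranges over the 2-element vertex sets; the description is well defined because the
  distance in a symmetric digraph is symmetric.
\<close>

definition wiener_index :: "('a, 'b) pre_digraph \<Rightarrow> real" where
  "wiener_index G =
     (\<Sum>p | p \<subseteq> verts G \<and> card p = 2. THE x. \<exists>u v. p = {u, v} \<and> x = graph_dist G u v)"

text \<open>The value at index 0 is deliberately left unspecified.\<close>

fun g :: "nat \<Rightarrow> real \<Rightarrow> real" where
  "g (Suc 0) x = x - 1"
| "g (Suc (Suc k)) x = x + g (Suc k) x - 2 * sqrt (g (Suc k) x)"

end

theory Submission
  imports Defs
begin

text \<open>
  A tree of diameter \<open>2l\<close> has a vertex within distance \<open>l\<close> of all others, and one of diameter
  \<open>2l + 1\<close> has an edge \<open>cc'\<close> such that every vertex is within distance \<open>l\<close> of \<open>c\<close> or \<open>c'\<close>.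
  Joining every other vertex to a neighbour closer to this centre gives a forest of depth at most
  \<open>l\<close>. The distance of \<open>u\<close> and \<open>v\<close> is at most the number of non-root vertices that are
  ancestors of exactly one of them, plus 1 if they hang below different roots. Double counting
  bounds the Wiener index by the sum of \<open>s\<^sub>w (n - s\<^sub>w)\<close> over the non-root vertices \<open>w\<close>, where
  \<open>s\<^sub>w\<close> is the size of the subtree at \<open>w\<close>, plus \<open>a (n - a) \<le> n\<^sup>2 / 4\<close> for the central edge.
  By AM-GM, \<open>s (n - s) \<le> s g\<^sub>k\<^sub>+\<^sub>1 - (s - 1) g\<^sub>k\<close>. Using this with \<open>k + h(w) = l\<close>, and
  distributing the right-hand side over the descendants of \<open>w\<close>, the terms along the path from
  a vertex to its root telescope to \<open>g\<^sub>l\<close>.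
\<close>

section \<open>The recursion for \<open>g\<close> as a completed square\<close>

lemma g_nonneg:
  assumes "x \<ge> 1" "k > 0"
  shows "g k x \<ge> 0"
  using assms(2)
proof (induction k rule: nat_induct_non_zero)
  case (Suc k)
  then obtain m where k: "k = Suc m"
    by (cases k) auto
  \<comment> \<open>The induction hypothesis \<open>g k x \<ge> 0\<close> is what lets
    \<open>sqrt (g k x)\<close> square back to \<open>g k x\<close>.\<close>
  have "g (Suc k) x = (x - 1) + (sqrt (g k x) - 1)\<^sup>2"
    using Suc by (simp add: k power2_diff)
  then show ?case
    using assms(1) by simp
qed (use assms(1) in simp)

text \<open>The recursion for \<open>g\<close> is made for this: the right side minus the left is a
  perfect square, whatever the real number \<open>s\<close>.\<close>

lemma g_step:
  assumes "x \<ge> 1" "k > 0"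
  shows "s * (x - s) \<le> s * g (Suc k) x - (s - 1) * g k x"
proof -
  obtain m where k: "k = Suc m"
    using assms(2) by (cases k) auto
  have "0 \<le> (s - sqrt (g k x))\<^sup>2"
    by simp
  also have "\<dots> = s * g (Suc k) x - (s - 1) * g k x - s * (x - s)"
    using g_nonneg[OF assms] by (simp add: k power2_diff algebra_simps power2_eq_square)
  finally show ?thesis
    by simp
qed

section \<open>Counting the pairs separated by a set\<close>

lemma sum_of_bool_neq:
  assumes "finite V"
  shows "(\<Sum>u\<in>V. \<Sum>v\<in>V. of_bool (P u \<noteq> P v) :: real) =
    2 * (real (card {v \<in> V. P v}) * (real (card V) - real (card {v \<in> V. P v})))"
proof -
  have split: "card V = card {v \<in> V. P v} + card {v \<in> V. \<not> P v}"
    using assms by (subst card_Un_disjoint[symmetric]) (auto intro: arg_cong[where f = card])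
  have "(\<Sum>u\<in>V. \<Sum>v\<in>V. of_bool (P u \<noteq> P v) :: real) =
    (\<Sum>u\<in>V. if P u then real (card {v \<in> V. \<not> P v}) else real (card {v \<in> V. P v}))"
  proof (rule sum.cong[OF refl])
    fix u
    have "(\<Sum>v\<in>V. of_bool (P u \<noteq> P v) :: real) = real (card {v \<in> V. P u \<noteq> P v})"
      using assms by (simp add: of_bool_def sum.If_cases Int_def)
    then show "(\<Sum>v\<in>V. of_bool (P u \<noteq> P v) :: real) =
      (if P u then real (card {v \<in> V. \<not> P v}) else real (card {v \<in> V. P v}))"
      by simp
  qed
  also have "\<dots> = 2 * (real (card {v \<in> V. P v}) * real (card {v \<in> V. \<not> P v}))"
    using assms by (simp add: sum.If_cases Int_def)
  finally show ?thesis
    by (simp add: split)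
qed

lemma card_sym_diff_eq_sum:
  assumes "finite V" "A \<subseteq> V" "B \<subseteq> V"
  shows "real (card (sym_diff A B)) = (\<Sum>w\<in>V. of_bool ((w \<in> A) \<noteq> (w \<in> B)))"
proof -
  have "sym_diff A B = {w \<in> V. (w \<in> A) \<noteq> (w \<in> B)}"
    using assms by auto
  then show ?thesis
    using assms by (simp add: of_bool_def sum.If_cases Int_def)
qed

text \<open>Expand each cardinality as a sum over \<open>w\<close> and move \<open>w\<close>
  outermost: each \<open>w\<close> then counts the ordered pairs it separates, that is, those with
  \<open>w\<close> in exactly one of the two sets.\<close>

lemma sum_card_sym_diff:
  assumes "finite V" "\<And>v. v \<in> V \<Longrightarrow> A v \<subseteq> V"
  shows "(\<Sum>u\<in>V. \<Sum>v\<in>V. real (card (sym_diff (A u) (A v)))) =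
    2 * (\<Sum>w\<in>V. real (card {v \<in> V. w \<in> A v}) * (real (card V) - real (card {v \<in> V. w \<in> A v})))"
proof -
  have "(\<Sum>u\<in>V. \<Sum>v\<in>V. real (card (sym_diff (A u) (A v)))) =
    (\<Sum>u\<in>V. \<Sum>v\<in>V. \<Sum>w\<in>V. of_bool ((w \<in> A u) \<noteq> (w \<in> A v)))"
    using assms by (intro sum.cong refl card_sym_diff_eq_sum) auto
  also have "\<dots> = (\<Sum>u\<in>V. \<Sum>w\<in>V. \<Sum>v\<in>V. of_bool ((w \<in> A u) \<noteq> (w \<in> A v)))"
    by (intro sum.cong refl sum.swap)
  also have "\<dots> = (\<Sum>w\<in>V. \<Sum>u\<in>V. \<Sum>v\<in>V. of_bool ((w \<in> A u) \<noteq> (w \<in> A v)))"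
    by (rule sum.swap)
  also have "\<dots> = (\<Sum>w\<in>V. 2 * (real (card {v \<in> V. w \<in> A v}) *
      (real (card V) - real (card {v \<in> V. w \<in> A v}))))"
    by (intro sum.cong refl sum_of_bool_neq assms)
  finally show ?thesis
    by (simp add: sum_distrib_left)
qed

section \<open>Rooted forests\<close>

text \<open>The roots are the vertices of depth 0, where \<open>parent\<close> is unconstrained.
  Since depth drops by one at each parent, iterating \<open>parent\<close> reaches a root.\<close>

locale rooted_forest =
  fixes V :: "'a set" and h :: "'a \<Rightarrow> nat" and parent :: "'a \<Rightarrow> 'a"
  assumes finite_V: "finite V"
    and parent_in_V: "v \<in> V \<Longrightarrow> h v > 0 \<Longrightarrow> parent v \<in> V"
    and h_parent: "v \<in> V \<Longrightarrow> h v > 0 \<Longrightarrow> Suc (h (parent v)) = h v"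
begin

text \<open>The root itself is not counted among the ancestors, but every other vertex is its own ancestor.\<close>

definition anc :: "'a \<Rightarrow> 'a set" where
  "anc v = (\<lambda>i. (parent ^^ i) v) ` {..<h v}"

lemma anc_root: "h v = 0 \<Longrightarrow> anc v = {}"
  by (simp add: anc_def)

lemma anc_rec: "v \<in> V \<Longrightarrow> h v > 0 \<Longrightarrow> anc v = insert v (anc (parent v))"
proof -
  assume "v \<in> V" "h v > 0"
  then have "{..<h v} = insert 0 (Suc ` {..<h (parent v)})"
    by (simp add: h_parent flip: lessThan_Suc_eq_insert_0)
  then show ?thesis
    by (auto simp: anc_def image_image funpow_swap1)
qed

lemma forest_induct [consumes 1, case_names root parent]:
  assumes "v \<in> V"
    and "\<And>v. v \<in> V \<Longrightarrow> h v = 0 \<Longrightarrow> P v"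
    and "\<And>v. v \<in> V \<Longrightarrow> h v > 0 \<Longrightarrow> P (parent v) \<Longrightarrow> P v"
  shows "P v"
  using assms(1)
proof (induction "h v" arbitrary: v rule: less_induct)
  case less
  then show ?case
    using assms(2,3) parent_in_V h_parent by (metis lessI neq0_conv)
qed

lemma finite_anc: "finite (anc v)"
  by (simp add: anc_def)

lemma anc_subset: "v \<in> V \<Longrightarrow> anc v \<subseteq> V"
  by (induction rule: forest_induct) (auto simp: anc_root anc_rec)

lemma h_pos_anc: "v \<in> V \<Longrightarrow> w \<in> anc v \<Longrightarrow> h w > 0"
  by (induction rule: forest_induct) (auto simp: anc_root anc_rec)

lemma h_less_anc: "v \<in> V \<Longrightarrow> w \<in> anc v \<Longrightarrow> w \<noteq> v \<Longrightarrow> h w < h v"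
proof (induction rule: forest_induct)
  case (parent v)
  then show ?case
    using h_parent[of v] by (cases "w = parent v") (auto simp: anc_rec)
qed (simp add: anc_root)

lemma not_in_anc_parent:
  assumes "v \<in> V" "h v > 0"
  shows "v \<notin> anc (parent v)"
  using h_less_anc[of "parent v" v] assms parent_in_V[of v] h_parent[of v] by fastforce

text \<open>Along \<open>anc v\<close> the depth takes each value from 1 to \<open>h v\<close>
  exactly once.\<close>

lemma sum_anc_telescope:
  fixes G :: "nat \<Rightarrow> real"
  assumes "v \<in> V"
  shows "(\<Sum>w\<in>anc v. G (h w) - G (Suc (h w))) = G 1 - G (Suc (h v))"
  using assms
  by (induction rule: forest_induct) (simp_all add: anc_root anc_rec finite_anc not_in_anc_parent h_parent)

text \<open>Dropping the subtracted term at \<open>v\<close> itself removes the boundary term, so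
  the total no longer depends on the depth of \<open>v\<close>.\<close>

lemma sum_anc_strict_telescope:
  fixes G :: "nat \<Rightarrow> real"
  assumes "v \<in> V" "h v > 0"
  shows "(\<Sum>w\<in>anc v. G (h w) - of_bool (w \<noteq> v) * G (Suc (h w))) = G 1"
proof -
  have "(\<Sum>w\<in>anc (parent v). G (h w) - of_bool (w \<noteq> v) * G (Suc (h w))) =
    (\<Sum>w\<in>anc (parent v). G (h w) - G (Suc (h w)))"
    using assms not_in_anc_parent by (intro sum.cong) auto
  then show ?thesis
    using assms by (simp add: anc_rec finite_anc not_in_anc_parent sum_anc_telescope parent_in_V h_parent)
qed

lemma sum_subtree_le:
  assumes V: "V \<noteq> {}" and depth: "\<And>v. v \<in> V \<Longrightarrow> h v \<le> l"
  defines "s \<equiv> \<lambda>w. real (card {v \<in> V. w \<in> anc v})"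
  shows "(\<Sum>w\<in>V. s w * (real (card V) - s w)) \<le> real (card {v \<in> V. h v > 0}) * g l (real (card V))"
proof -
  define n where "n = real (card V)"
  define G where "G j = g (Suc l - j) n" for j
    \<comment> \<open>\<open>G (Suc l)\<close> is the unspecified \<open>g 0\<close>; it only occurs with the factor \<open>s w - 1 = 0\<close>.\<close>
  have n: "n \<ge> 1"
    using V finite_V by (simp add: n_def Suc_le_eq card_gt_0_iff)
  have le: "s w * (n - s w) \<le> (\<Sum>v | v \<in> V \<and> w \<in> anc v. G (h w) - of_bool (w \<noteq> v) * G (Suc (h w)))"
    if w: "w \<in> V" for w
  proof (cases "h w = 0")
    case True
    then have "{v \<in> V. w \<in> anc v} = {}"
      using h_pos_anc by fastforce
    then show ?thesis
      unfolding s_def by (metis (no_types, lifting) card.empty mult_zero_left of_nat_0 order_refl sum.empty)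
  next
    case False
    define D where "D = {v \<in> V. w \<in> anc v}"
    have D: "finite D" "w \<in> D"
      using False w finite_V by (auto simp: D_def anc_rec)
    have sD: "s w = real (card D)"
      by (simp add: s_def D_def)
    \<comment> \<open>Every descendant of \<open>w\<close> carries one \<open>G (h w)\<close>, and
      each of the \<open>s w - 1\<close> proper ones also carries one
      \<open>- G (Suc (h w))\<close>.\<close>
    have "(\<Sum>v\<in>D. G (h w) - of_bool (w \<noteq> v) * G (Suc (h w))) =
      G (h w) + (\<Sum>v\<in>D - {w}. G (h w) - G (Suc (h w)))"
      using D by (subst sum.remove[of _ w]) (auto simp del: sum_constant intro: sum.cong)
    also have "\<dots> = s w * G (h w) - (s w - 1) * G (Suc (h w))"
      using D card_gt_0_iff[of D] by (auto simp: sD of_nat_diff algebra_simps)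
    also have "\<dots> \<ge> s w * (n - s w)"
    proof (cases "h w = l")
      case True
      \<comment> \<open>At maximal depth \<open>w\<close> is a leaf, so \<open>s w = 1\<close> and
        the claim is the equality \<open>n - 1 = g 1 n\<close>.\<close>
      have "v = w" if "v \<in> D" for v
        using that h_less_anc[of v w] depth[of v] True by (auto simp: D_def)
      then have "D = {w}"
        using D(2) by blast
      then show ?thesis
        by (simp add: sD G_def True)
    next
      case neq: False
      then have "h w < l"
        using depth[OF w] by simp
      then show ?thesis
        using g_step[OF n, of "l - h w" "s w"] by (simp add: G_def Suc_diff_le)
    qed
    finally show ?thesis
      by (simp add: D_def)
  qed
  have "(\<Sum>w\<in>V. s w * (n - s w)) \<le>
    (\<Sum>w\<in>V. \<Sum>v | v \<in> V \<and> w \<in> anc v. G (h w) - of_bool (w \<noteq> v) * G (Suc (h w)))"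
    by (intro sum_mono le)
  \<comment> \<open>Regrouping by descendant lets each vertex collect the shares of its own
    ancestors, which telescope.\<close>
  also have "\<dots> = (\<Sum>v\<in>V. \<Sum>w | w \<in> V \<and> w \<in> anc v. G (h w) - of_bool (w \<noteq> v) * G (Suc (h w)))"
    by (rule sum.swap_restrict) (use finite_V in auto)
  also have "\<dots> = (\<Sum>v\<in>V. \<Sum>w\<in>anc v. G (h w) - of_bool (w \<noteq> v) * G (Suc (h w)))"
    using anc_subset by (intro sum.cong) auto
  also have "\<dots> = (\<Sum>v\<in>V. if h v > 0 then G 1 else 0)"
    by (intro sum.cong) (auto simp: sum_anc_strict_telescope anc_root)
  also have "\<dots> = real (card {v \<in> V. h v > 0}) * G 1"
    using finite_V by (simp add: sum.If_cases Int_def)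
  finally show ?thesis
    by (simp add: n_def G_def)
qed

text \<open>Climb from the deeper endpoint to its parent: one step of distance removes one element
  of the symmetric difference. Once both ends are roots, the \<open>P\<close> term pays for the step
  between them.\<close>

lemma dist_le_sym_diff_anc:
  fixes \<delta> :: "'a \<Rightarrow> 'a \<Rightarrow> nat"
  assumes sym: "\<And>u v. u \<in> V \<Longrightarrow> v \<in> V \<Longrightarrow> \<delta> u v = \<delta> v u"
    and refl: "\<And>u. u \<in> V \<Longrightarrow> \<delta> u u = 0"
    and step: "\<And>u v. u \<in> V \<Longrightarrow> v \<in> V \<Longrightarrow> h u > 0 \<Longrightarrow> \<delta> u v \<le> Suc (\<delta> (parent u) v)"
    and root: "\<And>u v. u \<in> V \<Longrightarrow> v \<in> V \<Longrightarrow> h u = 0 \<Longrightarrow> h v = 0 \<Longrightarrow> \<delta> u v \<le> of_bool (P u \<noteq> P v)"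
    and P: "\<And>v. v \<in> V \<Longrightarrow> h v > 0 \<Longrightarrow> P (parent v) = P v"
    and "u \<in> V" "v \<in> V"
  shows "\<delta> u v \<le> card (sym_diff (anc u) (anc v)) + of_bool (P u \<noteq> P v)"
  using assms(6,7)
proof (induction "h u + h v" arbitrary: u v rule: less_induct)
  case less
  have up: "\<delta> x y \<le> card (sym_diff (anc x) (anc y)) + of_bool (P x \<noteq> P y)"
    if xy: "x \<in> V" "y \<in> V" "x \<noteq> y" "h x > 0" "h y \<le> h x" "h x + h y = h u + h v" for x y
  proof -
    \<comment> \<open>Ancestors of \<open>y\<close> other than \<open>y\<close> are strictly
      shallower than \<open>y\<close>, while \<open>x\<close> is at least as deep.\<close>
    have "x \<notin> anc y"
      using h_less_anc[of y x] xy by auto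
    then have "sym_diff (anc x) (anc y) = insert x (sym_diff (anc (parent x)) (anc y))"
      using xy not_in_anc_parent[of x] by (auto simp: anc_rec)
    moreover have "x \<notin> sym_diff (anc (parent x)) (anc y)"
      using xy not_in_anc_parent[of x] \<open>x \<notin> anc y\<close> by auto
    ultimately have "card (sym_diff (anc x) (anc y)) = Suc (card (sym_diff (anc (parent x)) (anc y)))"
      by (simp add: finite_anc)
    moreover have "\<delta> (parent x) y \<le> card (sym_diff (anc (parent x)) (anc y)) + of_bool (P (parent x) \<noteq> P y)"
      using xy h_parent[of x] by (intro less.hyps) (auto simp: parent_in_V)
    ultimately show ?thesis
      using step[of x y] P[of x] xy by simp
  qed
  consider "u = v" | "h u = 0" "h v = 0" | "u \<noteq> v" "h u > 0" "h v \<le> h u" | "u \<noteq> v" "h v > 0" "h u \<le> h v"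
    by linarith
  then show ?case
  proof cases
    case 4
    then show ?thesis
      using up[of v u] less.prems sym by (simp add: Un_commute eq_commute)
  qed (use less.prems refl root up in \<open>auto simp: anc_root\<close>)
qed

end


section \<open>Shortest walks in connected graphs\<close>

locale connected_graph = graph +
  assumes strongly_connected: "strongly_connected G"
begin

text \<open>The distance as a natural number attained by a walk, in place of an infimum in the
  extended reals.\<close>

definition hop :: "'a \<Rightarrow> 'a \<Rightarrow> nat" where
  "hop u v = (LEAST k. \<exists>p. awalk u p v \<and> length p = k)"

lemma hop_le_length: "awalk u p v \<Longrightarrow> hop u v \<le> length p"
  unfolding hop_def by (rule Least_le) auto

lemma shortest_awalkE:
  assumes "u \<in> verts G" "v \<in> verts G"
  obtains p where "awalk u p v" "length p = hop u v"
proof -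
  have "\<exists>k p. awalk u p v \<and> length p = k"
    using assms strongly_connected by (auto simp: strongly_connected_def reachable_awalk)
  from LeastI_ex[OF this] show ?thesis
    using that unfolding hop_def by blast
qed

lemma graph_dist_eq_hop:
  assumes "u \<in> verts G" "v \<in> verts G"
  shows "graph_dist G u v = real (hop u v)"
proof -
  have cost: "awalk_cost (\<lambda>_. 1) p = real (length p)" for p :: "'b list"
    by (induction p) auto
  obtain p where p: "awalk u p v" "length p = hop u v"
    using shortest_awalkE assms by blast
  have "\<mu> (\<lambda>_. 1) u v = ereal (real (hop u v))"
  proof (rule antisym)
    show "\<mu> (\<lambda>_. 1) u v \<le> ereal (real (hop u v))"
      using min_cost_le_walk_cost[OF p(1), of "\<lambda>_. 1"] by (simp add: cost p)
    show "ereal (real (hop u v)) \<le> \<mu> (\<lambda>_. 1) u v"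
      unfolding \<mu>_def by (rule INF_greatest) (auto simp: cost hop_le_length)
  qed
  then show ?thesis
    by (simp add: graph_dist_def)
qed

lemma awalk_reverse: "awalk u p v \<Longrightarrow> \<exists>q. awalk v q u \<and> length q = length p"
proof (induction p arbitrary: u)
  case (Cons e p)
  then obtain q where q: "awalk v q (head G e)" "length q = length p"
    by (auto simp: awalk_Cons_iff)
  obtain f where "f \<in> arcs G" "tail G f = head G e" "head G f = tail G e"
    using Cons.prems sym_arcs by (auto simp: awalk_Cons_iff symmetric_conv)
  then have "awalk v (q @ [f]) u"
    using q Cons.prems by (auto simp: awalk_Cons_iff awalk_Nil_iff intro!: awalk_appendI)
  then show ?case
    using q by (intro exI[of _ "q @ [f]"]) simp
qed (auto simp: awalk_Nil_iff)

lemma hop_sym: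
  assumes "u \<in> verts G" "v \<in> verts G"
  shows "hop u v = hop v u"
proof -
  have "hop x y \<le> hop y x" if "x \<in> verts G" "y \<in> verts G" for x y
    using shortest_awalkE[OF that(2,1)] awalk_reverse hop_le_length by metis
  then show ?thesis
    using assms by (simp add: le_antisym)
qed

lemma hop_triangle:
  assumes "u \<in> verts G" "v \<in> verts G" "w \<in> verts G"
  shows "hop u w \<le> hop u v + hop v w"
proof -
  obtain p q where "awalk u p v" "length p = hop u v" "awalk v q w" "length q = hop v w"
    using shortest_awalkE assms by metis
  then show ?thesis
    using hop_le_length[of u "p @ q" w] awalk_appendI by fastforce
qed

lemma hop_self [simp]: "u \<in> verts G \<Longrightarrow> hop u u = 0"
  using hop_le_length[of u "[]" u] by (simp add: awalk_Nil_iff)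

lemma hop_eq_0_iff: "u \<in> verts G \<Longrightarrow> v \<in> verts G \<Longrightarrow> hop u v = 0 \<longleftrightarrow> u = v"
  by (metis awalk_Nil_iff hop_self length_0_conv shortest_awalkE)

text \<open>Used contrapositively: a walk too short for a detour via \<open>c\<close> avoids
  \<open>c\<close>.\<close>

lemma hop_split:
  assumes "awalk u p v" "c \<in> set (awalk_verts u p)"
  shows "hop u c + hop c v \<le> length p"
proof -
  obtain q r where "p = q @ r" "awalk u q c" "awalk c r v"
    using awalk_decomp[OF assms] by blast
  then show ?thesis
    using hop_le_length[of u q c] hop_le_length[of c r v] by simp
qed

text \<open>Take the second vertex of a shortest walk. It differs from \<open>u\<close> because
  there are no loops, and the rest of the walk is again shortest by the triangle inequality.\<close>

lemma hop_first_step: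
  assumes "u \<in> verts G" "v \<in> verts G" "u \<noteq> v"
  obtains z where "z \<in> verts G" "hop u z = 1" "hop u v = Suc (hop z v)"
proof -
  obtain p where p: "awalk u p v" "length p = hop u v"
    using shortest_awalkE assms by blast
  obtain e q where eq: "p = e # q"
    using p(1) assms(3) by (cases p) (auto simp: awalk_Nil_iff)
  define z where "z = head G e"
  have e: "e \<in> arcs G" "tail G e = u" "awalk z q v"
    using p(1) by (auto simp: eq awalk_Cons_iff z_def)
  have z: "z \<in> verts G" "z \<noteq> u"
    using e no_loops[of e] by (auto simp: z_def)
  have "hop u z \<le> 1"
    using hop_le_length[OF arc_implies_awalk, of e] e by (simp add: z_def)
  moreover have "hop z v \<le> length q"
    using hop_le_length e by blast
  moreover have "hop u z \<noteq> 0"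
    using z assms by (simp add: hop_eq_0_iff)
  ultimately show ?thesis
    using that[OF z(1)] hop_triangle[OF assms(1) z(1) assms(2)] p eq by simp
qed

lemma hop_eq_1E:
  assumes "u \<in> verts G" "v \<in> verts G" "hop u v = 1"
  obtains e where "e \<in> arcs G" "tail G e = u" "head G e = v"
proof -
  obtain p where "awalk u p v" "length p = 1"
    using shortest_awalkE assms by metis
  then show ?thesis
    using that by (auto simp: length_Suc_conv awalk_Cons_iff awalk_Nil_iff)
qed

lemma hop_intermediate:
  assumes "u \<in> verts G" "v \<in> verts G" "j \<le> hop u v"
  obtains c where "c \<in> verts G" "hop u c = j" "hop u v = j + hop c v"
proof -
  have "\<exists>c\<in>verts G. hop u c = j \<and> hop u v = j + hop c v"
    using assms(3)
  proof (induction j)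
    case 0
    then show ?case
      using assms(1) by (intro bexI[of _ u]) auto
  next
    case (Suc j)
    then obtain c where c: "c \<in> verts G" "hop u c = j" "hop u v = j + hop c v"
      by auto
    then have "c \<noteq> v"
      using Suc.prems assms by auto
    then obtain z where z: "z \<in> verts G" "hop c z = 1" "hop c v = Suc (hop z v)"
      using hop_first_step c(1) assms(2) by blast
    then show ?case
      using c hop_triangle[OF assms(1) c(1) z(1)] hop_triangle[OF assms(1) z(1) assms(2)]
      by (intro bexI[of _ z]) auto
  qed
  then show ?thesis
    using that by blast
qed

text \<open>The map from \<open>(u, v)\<close> to \<open>{u, v}\<close> is two-to-one off the
  diagonal, and the diagonal contributes 0.\<close>

lemma wiener_index_eq: "2 * wiener_index G = (\<Sum>u\<in>verts G. \<Sum>v\<in>verts G. real (hop u v))"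
proof -
  define S where "S = {(u, v). u \<in> verts G \<and> v \<in> verts G \<and> u \<noteq> v}"
  have S_sub: "S \<subseteq> verts G \<times> verts G"
    by (auto simp: S_def)
  then have fin: "finite S"
    by (rule finite_subset) simp
  have img: "(\<lambda>(u, v). {u, v}) ` S = {p. p \<subseteq> verts G \<and> card p = 2}"
    by (auto simp: S_def card_2_iff image_iff)
  have "(\<Sum>u\<in>verts G. \<Sum>v\<in>verts G. real (hop u v)) = (\<Sum>(u, v)\<in>verts G \<times> verts G. real (hop u v))"
    by (simp add: sum.cartesian_product)
  also have "\<dots> = (\<Sum>(u, v)\<in>S. real (hop u v))"
    using S_sub by (intro sum.mono_neutral_right) (auto simp: S_def)
  also have "\<dots> = (\<Sum>p | p \<subseteq> verts G \<and> card p = 2.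
      \<Sum>(u, v) | (u, v) \<in> S \<and> {u, v} = p. real (hop u v))"
    using sum.image_gen[OF fin, of "\<lambda>(u, v). real (hop u v)" "\<lambda>(u, v). {u, v}"]
    unfolding img by (simp add: split_def)
  also have "\<dots> = (\<Sum>p | p \<subseteq> verts G \<and> card p = 2.
      2 * (THE x. \<exists>u v. p = {u, v} \<and> x = graph_dist G u v))"
  proof (rule sum.cong[OF refl])
    fix p
    assume "p \<in> {p. p \<subseteq> verts G \<and> card p = 2}"
    then obtain u v where uv: "p = {u, v}" "u \<noteq> v" "u \<in> verts G" "v \<in> verts G"
      by (auto simp: card_2_iff)
    have "{x. case x of (a, b) \<Rightarrow> (a, b) \<in> S \<and> {a, b} = p} = {(u, v), (v, u)}"
      using uv by (auto simp: S_def doubleton_eq_iff)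
    moreover have "(THE x. \<exists>u v. p = {u, v} \<and> x = graph_dist G u v) = real (hop u v)"
    proof (rule the_equality)
      show "\<exists>a b. p = {a, b} \<and> real (hop u v) = graph_dist G a b"
        using uv graph_dist_eq_hop by metis
      show "x = real (hop u v)" if "\<exists>a b. p = {a, b} \<and> x = graph_dist G a b" for x
        using that uv by (metis doubleton_eq_iff graph_dist_eq_hop hop_sym)
    qed
    ultimately show "(\<Sum>(u, v) | (u, v) \<in> S \<and> {u, v} = p. real (hop u v)) =
      2 * (THE x. \<exists>u v. p = {u, v} \<and> x = graph_dist G u v)"
      using uv hop_sym[of u v] by simp
  qed
  finally show ?thesis
    by (simp add: wiener_index_def sum_distrib_left)
qed

text \<open>The case \<open>c = c'\<close> serves even diameter, adjacent \<open>c\<close> and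
  \<open>c'\<close> odd diameter. The witness \<open>a\<close> counts the vertices whose root is
  \<open>c\<close>; with a single root this is all of them, and \<open>a * (n - a)\<close>
  vanishes.\<close>

lemma wiener_index_le:
  assumes c: "c \<in> verts G" "c' \<in> verts G" "hop c c' \<le> 1"
    and depth: "\<And>v. v \<in> verts G \<Longrightarrow> hop v c \<le> l \<or> hop v c' \<le> l"
  defines "n \<equiv> real (card (verts G))"
  shows "\<exists>a. wiener_index G \<le> (n - real (card {c, c'})) * g l n + a * (n - a) \<and> (c = c' \<longrightarrow> a = n)"
proof -
  define h where "h v = min (hop v c) (hop v c')" for v
  have "\<exists>z\<in>verts G. hop v z = 1 \<and> Suc (h z) = h v" if v: "v \<in> verts G" "h v > 0" for v
  proof -
    obtain r where r: "r \<in> {c, c'}" "hop v r = h v"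
      unfolding h_def min_def by (metis insertI1 insertI2)
    then have "v \<noteq> r"
      using v by auto
    then obtain z where z: "z \<in> verts G" "hop v z = 1" "hop v r = Suc (hop z r)"
      using hop_first_step v(1) r(1) c by blast
    \<comment> \<open>One step towards the nearer centre lowers \<open>h\<close> by at least one,
      and the triangle inequality forbids more.\<close>
    have "h v \<le> Suc (h z)"
      using hop_triangle[OF v(1) z(1) c(1)] hop_triangle[OF v(1) z(1) c(2)] z by (auto simp: h_def)
    then show ?thesis
      using z r by (intro bexI[of _ z]) (auto simp: h_def)
  qed
  then obtain parent where parent: "parent v \<in> verts G" "hop v (parent v) = 1" "Suc (h (parent v)) = h v"
    if "v \<in> verts G" "h v > 0" for v
    by metis
  interpret F: rooted_forest "verts G" h parent
    by unfold_locales (use parent in auto)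
  \<comment> \<open>Climbing \<open>h v\<close> times ends at the root above
    \<open>v\<close>.\<close>
  define P where "P v \<longleftrightarrow> (parent ^^ h v) v = c" for v
  have P_parent: "P (parent v) = P v" if "v \<in> verts G" "h v > 0" for v
    using parent(3)[OF that] by (simp add: P_def funpow_swap1 flip: parent(3)[OF that])
  have roots: "{v \<in> verts G. h v = 0} = {c, c'}"
    using c by (auto simp: h_def min_def hop_eq_0_iff split: if_splits)
  have le: "hop u v \<le> card (sym_diff (F.anc u) (F.anc v)) + of_bool (P u \<noteq> P v)"
    if uv: "u \<in> verts G" "v \<in> verts G" for u v
  proof (rule F.dist_le_sym_diff_anc[where \<delta> = hop and P = P, OF _ _ _ _ P_parent uv])
    fix u v
    assume uv: "u \<in> verts G" "v \<in> verts G"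
    show "hop u v = hop v u"
      using uv by (rule hop_sym)
    show "hop u v \<le> Suc (hop (parent u) v)" if "h u > 0"
      using hop_triangle[OF uv(1) parent(1) uv(2)] uv that parent(2) by fastforce
    show "hop u v \<le> of_bool (P u \<noteq> P v)" if "h u = 0" "h v = 0"
    proof -
      have "u \<in> {c, c'}" "v \<in> {c, c'}"
        using uv that roots by auto
      then show ?thesis
        using that c hop_sym[of c c'] by (auto simp: P_def)
    qed
  qed auto
  define a where "a = real (card {v \<in> verts G. P v})"
  have "2 * wiener_index G \<le> (\<Sum>u\<in>verts G. \<Sum>v\<in>verts G.
      real (card (sym_diff (F.anc u) (F.anc v))) + of_bool (P u \<noteq> P v))"
    unfolding wiener_index_eq using le by (intro sum_mono) (metis of_nat_add of_nat_mono of_nat_of_bool)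
  also have "\<dots> = 2 * (\<Sum>w\<in>verts G.
      real (card {v \<in> verts G. w \<in> F.anc v}) * (n - real (card {v \<in> verts G. w \<in> F.anc v})))
      + 2 * (a * (n - a))"
    unfolding sum.distrib n_def a_def
    by (subst sum_of_bool_neq, simp, subst sum_card_sym_diff) (use F.anc_subset in auto)
  also have "\<dots> \<le> 2 * (real (card {v \<in> verts G. h v > 0}) * g l n) + 2 * (a * (n - a))"
    using F.sum_subtree_le[of l] c depth by (fastforce simp: n_def h_def min_le_iff_disj)
  also have "real (card {v \<in> verts G. h v > 0}) = n - real (card {c, c'})"
  proof -
    have "card (verts G) = card ({v \<in> verts G. h v > 0} \<union> {v \<in> verts G. h v = 0})"
      by (rule arg_cong[where f = card]) auto
    also have "\<dots> = card {v \<in> verts G. h v > 0} + card {v \<in> verts G. h v = 0}"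
      by (rule card_Un_disjoint) auto
    finally show ?thesis
      by (simp add: roots n_def)
  qed
  finally have "wiener_index G \<le> (n - real (card {c, c'})) * g l n + a * (n - a)"
    by simp
  moreover have "a = n" if "c = c'"
  proof -
    have "P v" if "v \<in> verts G" for v
      using that
    proof (induction rule: F.forest_induct)
      case (root v)
      then show ?case
        using roots \<open>c = c'\<close> by (auto simp: P_def)
    qed (simp add: P_parent)
    then have "{v \<in> verts G. P v} = verts G"
      by auto
    then show ?thesis
      by (simp add: a_def n_def)
  qed
  ultimately show ?thesis
    by blast
qed

end

section \<open>Branches and centres of trees\<close>

locale acyclic_graph = connected_graph +
  assumes acyclic: "cycle p \<Longrightarrow> length p < 3"
begin

text \<open>If a shortest walk from \<open>w\<close> to \<open>u\<close> avoided \<open>c\<close>, it would close a cycle through \<open>z\<close>, \<open>c\<close>, \<open>x\<close>.\<close>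

lemma hop_through:
  assumes verts: "c \<in> verts G" "z \<in> verts G" "x \<in> verts G" "w \<in> verts G" "u \<in> verts G"
    and z: "hop c z = 1" "hop c w = Suc (hop z w)"
    and x: "hop c x = 1" "hop c u = Suc (hop x u)"
    and "z \<noteq> x"
  shows "hop w c + hop c u \<le> hop w u"
proof (rule ccontr)
  assume neg: "\<not> hop w c + hop c u \<le> hop w u"
  obtain p where p: "awalk w p u" "length p = hop w u"
    using shortest_awalkE verts by blast
  obtain q where q: "awalk z q w" "length q = hop z w"
    using shortest_awalkE verts by blast
  obtain r where r: "awalk u r x" "length r = hop u x"
    using shortest_awalkE verts by blast
  have "c \<notin> set (awalk_verts w p)"
    using hop_split[OF p(1)] neg p(2) by auto
  \<comment> \<open>\<open>q\<close> is shorter than the distance from \<open>c\<close> to its end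
    \<open>w\<close>, so it cannot pass through \<open>c\<close>; likewise for \<open>r\<close> and
    \<open>u\<close>.\<close>
  moreover have "c \<notin> set (awalk_verts z q)"
    using hop_split[OF q(1), of c] q(2) z(2) by auto
  moreover have "c \<notin> set (awalk_verts u r)"
    using hop_split[OF r(1), of c] r(2) x(2) verts hop_sym by fastforce
  moreover have walk: "awalk z (q @ p @ r) x"
    using p q r by (meson awalk_appendI)
  ultimately have c_walk: "c \<notin> set (awalk_verts z (q @ p @ r))"
    using p q r by (auto simp: set_awalk_verts_append)
  \<comment> \<open>Shortcutting to a path uses only arcs of the walk, so \<open>c\<close> is still
    avoided.\<close>
  define t where "t = awalk_to_apath (q @ p @ r)"
  have t: "apath z t x" "c \<notin> set (awalk_verts z t)"
  proof -
    show "apath z t x"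
      using apath_awalk_to_apath[OF walk] by (simp add: t_def)
    then have "awalk z t x"
      by (simp add: apath_def)
    moreover have "set t \<subseteq> set (q @ p @ r)"
      using awalk_to_apath_subset[OF walk] by (simp add: t_def)
    ultimately show "c \<notin> set (awalk_verts z t)"
      using c_walk unfolding set_awalk_verts[OF walk] set_awalk_verts[OF \<open>awalk z t x\<close>] by auto
  qed
  \<comment> \<open>This gives the closed walk \<open>e # t @ [f]\<close> length at least 3.\<close>
  have "t \<noteq> []"
    using t(1) \<open>z \<noteq> x\<close> by (auto simp: apath_Nil_iff)
  obtain e where e: "e \<in> arcs G" "tail G e = c" "head G e = z"
    using hop_eq_1E verts z(1) by metis
  obtain f where f: "f \<in> arcs G" "tail G f = x" "head G f = c"
    using hop_eq_1E[of x c] verts x(1) hop_sym by metis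
  have tf: "awalk z (t @ [f]) c"
    using t(1) f verts by (auto simp: apath_def awalk_Cons_iff awalk_Nil_iff intro!: awalk_appendI)
  then have "awalk c (e # t @ [f]) c"
    using e by (simp add: awalk_Cons_iff verts(1) del: awalk_append_iff)
  moreover have "awalk_verts z (t @ [f]) = awalk_verts z t @ [c]"
    using awalk_verts_append[OF tf] f t(1) by (auto simp: apath_def)
  then have "distinct (tl (awalk_verts c (e # t @ [f])))"
    using t e by (simp add: apath_def)
  ultimately have "cycle (e # t @ [f])"
    unfolding cycle_def by blast
  then have "length (e # t @ [f]) < 3"
    by (rule acyclic)
  then show False
    using \<open>t \<noteq> []\<close> by (cases t) auto
qed

text \<open>Take the middle of a diametral walk from \<open>u\<close> to \<open>v\<close>. The
  branch at \<open>c\<close> containing \<open>w\<close> misses that of \<open>u\<close> or that of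
  \<open>v\<close>; the shortest walk from \<open>w\<close> to that end passes \<open>c\<close>, and
  the diameter bounds its length.\<close>

lemma center_exists:
  assumes le: "\<And>x y. x \<in> verts G \<Longrightarrow> y \<in> verts G \<Longrightarrow> hop x y \<le> d"
    and uv: "u \<in> verts G" "v \<in> verts G" "hop u v = d"
    and l: "d = 2 * l \<or> d = 2 * l + 1" "l > 0"
  obtains c c' where "c \<in> verts G" "c' \<in> verts G" "hop c c' = d - 2 * l"
    "\<And>w. w \<in> verts G \<Longrightarrow> hop w c \<le> l \<or> hop w c' \<le> l"
proof -
  obtain c where c: "c \<in> verts G" "hop u c = l" "hop c v = d - l"
  proof -
    have "l \<le> hop u v"
      using uv(3) l by auto
    from hop_intermediate[OF uv(1,2) this] show ?thesis
      using that uv(3) by (metis diff_add_inverse)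
  qed
  obtain c' where c': "c' \<in> verts G" "hop c c' = d - 2 * l" "hop c' v = l"
  proof -
    have "d - 2 * l \<le> hop c v"
      using c(3) l by auto
    from hop_intermediate[OF c(1) uv(2) this] obtain c'
      where "c' \<in> verts G" "hop c c' = d - 2 * l" "hop c v = d - 2 * l + hop c' v"
      by blast
    then show ?thesis
      using that[of c'] c(3) l by auto
  qed
  have "c \<noteq> u" "c \<noteq> v"
    using c uv l by auto
  then obtain x where x: "x \<in> verts G" "hop c x = 1" "hop c u = Suc (hop x u)"
    using hop_first_step c(1) uv(1) by blast
  \<comment> \<open>For odd \<open>d\<close>, the first step towards \<open>v\<close> is chosen to
    be the second centre.\<close>
  obtain y where y: "y \<in> verts G" "hop c y = 1" "hop c v = Suc (hop y v)" "d = 2 * l + 1 \<longrightarrow> y = c'"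
  proof (cases "d = 2 * l + 1")
    case True
    then show ?thesis
      using that[of c'] c c' by simp
  next
    case False
    then show ?thesis
      using hop_first_step[OF c(1) uv(2) \<open>c \<noteq> v\<close>] that by metis
  qed
  \<comment> \<open>Otherwise \<open>u\<close> and \<open>v\<close> would be joined via
    \<open>x\<close> in \<open>d - 2\<close> steps.\<close>
  have "x \<noteq> y"
    using hop_triangle[of u x v] x y c uv l hop_sym[of u c] hop_sym[of u x] by auto
  have "hop w c \<le> l \<or> hop w c' \<le> l" if w: "w \<in> verts G" for w
  proof (cases "w = c")
    case False
    then obtain z where z: "z \<in> verts G" "hop c z = 1" "hop c w = Suc (hop z w)"
      using hop_first_step[OF c(1) w] by metis
    show ?thesis
    proof (cases "z = y")
      case True
      \<comment> \<open>For odd \<open>d\<close> this gives only \<open>hop w c \<le> l + 1\<close>,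
        but \<open>w\<close> lies beyond \<open>c' = y\<close>, hence one step closer to
        \<open>c'\<close>.\<close>
      then have "hop w c + l \<le> d"
        using hop_through[OF c(1) z(1) x(1) w uv(1) z(2,3) x(2,3)] \<open>x \<noteq> y\<close> le[OF w uv(1)]
          hop_sym[of c u] c uv by auto
      then show ?thesis
        using l(1) y(4) z(3) True w c c' hop_sym[of c w] hop_sym[of c' w] by auto
    next
      case neq: False
      then have "hop w c + (d - l) \<le> d"
        using hop_through[OF c(1) z(1) y(1) w uv(2) z(2,3) y(2,3)] le[OF w uv(2)] c by auto
      then show ?thesis
        using l by auto
    qed
  qed (use c in auto)
  then show ?thesis
    using that[of c c'] c c' by blast
qed

end

section \<open>The bounds for even and odd diameter\<close>

theorem theorem4p6:
  fixes T :: "('a, 'b) pre_digraph" and d n :: nat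
  assumes "undirected_tree T"
    and "graph_diameter T = real d" and "d \<ge> 2"
    and "card (verts T) = n"
  shows "(\<forall>l::nat. d = 2 * l \<longrightarrow> wiener_index T \<le> (real n - 1) * g l (real n)) \<and>
         (\<forall>l::nat. d = 2 * l + 1 \<longrightarrow>
            wiener_index T \<le> (real n - 2) * g l (real n) + (real n)\<^sup>2 / 4)"
proof -
  interpret graph T
    using assms(1) by (simp add: undirected_tree_def)
  have "strongly_connected T"
    using assms(1)
    by (auto simp: undirected_tree_def symmetric_connected_imp_strongly_connected sym_arcs)
  then interpret acyclic_graph T
    by unfold_locales (use assms(1) in \<open>auto simp: undirected_tree_def not_less[symmetric]\<close>)
  define D where "D = {graph_dist T u v | u v. u \<in> verts T \<and> v \<in> verts T}"
  have "D = (\<lambda>(u, v). graph_dist T u v) ` (verts T \<times> verts T)"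
    by (auto simp: D_def)
  \<comment> \<open>With these, the maximum defining the diameter is attained by some pair
    \<open>u\<close>, \<open>v\<close>.\<close>
  then have D: "finite D" "D \<noteq> {}"
    using \<open>strongly_connected T\<close> by (auto simp: strongly_connected_def)
  have max: "Max D = real d"
    using assms(2) by (simp add: graph_diameter_def D_def)
  have le: "hop x y \<le> d" if "x \<in> verts T" "y \<in> verts T" for x y
  proof -
    have "graph_dist T x y \<in> D"
      using that by (auto simp: D_def)
    then have "graph_dist T x y \<le> real d"
      using Max_ge[OF D(1)] by (simp add: max)
    then show ?thesis
      using that by (simp add: graph_dist_eq_hop)
  qed
  obtain u v where uv: "u \<in> verts T" "v \<in> verts T" "hop u v = d"
    using Max_in[OF D] unfolding max by (auto simp: D_def graph_dist_eq_hop)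
  show ?thesis
  proof (intro conjI allI impI)
    fix l
    assume l: "d = 2 * l"
    obtain c c' where c: "c \<in> verts T" "c' \<in> verts T" "hop c c' = d - 2 * l"
      "\<And>w. w \<in> verts T \<Longrightarrow> hop w c \<le> l \<or> hop w c' \<le> l"
      using center_exists[OF le uv, of l] l assms(3) by auto
    then have "c = c'"
      using l by (simp add: hop_eq_0_iff)
    then show "wiener_index T \<le> (real n - 1) * g l (real n)"
      using wiener_index_le[of c c' l] c l assms(4) by auto
  next
    fix l
    assume l: "d = 2 * l + 1"
    obtain c c' where c: "c \<in> verts T" "c' \<in> verts T" "hop c c' = d - 2 * l"
      "\<And>w. w \<in> verts T \<Longrightarrow> hop w c \<le> l \<or> hop w c' \<le> l"
      using center_exists[OF le uv, of l] l assms(3) by auto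
    then have "c \<noteq> c'"
      using l by auto
    then obtain a where a: "wiener_index T \<le> (real n - 2) * g l (real n) + a * (real n - a)"
      using wiener_index_le[of c c' l] c l assms(4) by auto
    \<comment> \<open>AM-GM for the central edge, valid for any real \<open>a\<close>.\<close>
    have "0 \<le> (real n - 2 * a)\<^sup>2"
      by simp
    then have "a * (real n - a) \<le> (real n)\<^sup>2 / 4"
      by (simp add: power2_eq_square algebra_simps)
    then show "wiener_index T \<le> (real n - 2) * g l (real n) + (real n)\<^sup>2 / 4"
      using a by simp
  qed
qed

end
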